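(* Consider a DSPI game with discrete interdiction in which all agents have the same source node $s$ and the same target node $t$. Let $x^*=(x^{*1},\dots,x^{*F})$ be an optimal solution of the centralized problem $$\max_{x^1,\dots,x^F}\ \min_{p\in P^{st}} d_p(x^1,\dots,x^F)\quad\text{subject to}\quad \sum_{(u,v)\in A}c^f_{uv}x^f_{uv}\le b^f\ \ \forall f\in\mathcal F,\qquad x^f_{uv}\in\{0,1\}\ \ \forall (u,v)\in A,\ f\in\mathcal F .$$ Then $x^*$ is a pure strategy Nash equilibrium of the DSPI game.
   Context: $G=(V,A)$ is a finite directed network, $\mathcal F=\{1,\dots,F\}$ is a finite set of agents, agent $f$ has budget $b^f>0$ and arc interdiction costs $c^f_{uv}>0$. $P^{st}$ is the (nonempty) set of directed $s$-$t$ paths. $d^0_{uv}$ are initial arc lengths, $e_{uv}\ge 0$ are arc extensions, and the length of a path $p$ is $$d_p(x^1,\dots,x^F)=\sum_{(u,v)\in p}\Big(d^0_{uv}+e_{uv}\max_{g\in\mathcal F}x^g_{uv}\Big).$$ In the DSPI game with discrete interdiction and common source-target pair, each agent $f$ chooses $x^f\in\{0,1\}^A$ subject to $\sum_{(u,v)\in A}c^f_{uv}x^f_{uv}\le b^f$ so as to maximize $\min_{p\in P^{st}}d_p(x^f,x^{-f})$, where $x^{-f}$ denotes the other agents' decisions. A pure strategy Nash equilibrium is a profile in which each $x^f$ is feasible and optimal for agent $f$ given $x^{-f}$. *)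

theory Defs
  imports "Graph_Theory.Graph_Theory"
begin

text \<open>
  Agent \<open>f\<close>'s decision is a function in \<open>{0, 1}\<^sup>A\<close>, modelled as an extensional
  function on the arc set. The agents are \<open>1, \<dots>, F\<close>.
\<close>

locale dspi_game = pair_fin_digraph G for G :: "'a pair_pre_digraph" +
  fixes s t :: 'a
    and F :: nat
    and b :: "nat \<Rightarrow> real"
    and c :: "nat \<Rightarrow> 'a \<times> 'a \<Rightarrow> real"
    and d0 e :: "'a \<times> 'a \<Rightarrow> real"
  assumes path_exists: "\<exists>p. apath s p t"
    and budget_pos: "f \<in> {1..F} \<Longrightarrow> 0 < b f"
    and cost_pos: "\<lbrakk>f \<in> {1..F}; a \<in> parcs G\<rbrakk> \<Longrightarrow> 0 < c f a"
    and extension_nonneg: "a \<in> parcs G \<Longrightarrow> 0 \<le> e a"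
begin

definition paths :: "('a \<times> 'a) awalk set" where
  "paths = {p. apath s p t}"

definition path_length :: "(nat \<Rightarrow> 'a \<times> 'a \<Rightarrow> real) \<Rightarrow> ('a \<times> 'a) awalk \<Rightarrow> real" where
  "path_length x p = awalk_cost (\<lambda>a. d0 a + e a * (MAX g\<in>{1..F}. x g a)) p"

text \<open>The minimum is attained: a finite digraph has only finitely many simple paths.\<close>

definition shortest_length :: "(nat \<Rightarrow> 'a \<times> 'a \<Rightarrow> real) \<Rightarrow> real" where
  "shortest_length x = (MIN p\<in>paths. path_length x p)"

definition strategies :: "nat \<Rightarrow> ('a \<times> 'a \<Rightarrow> real) set" where
  "strategies f = {y \<in> parcs G \<rightarrow>\<^sub>E {0, 1}. (\<Sum>a\<in>parcs G. c f a * y a) \<le> b f}"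

definition profiles :: "(nat \<Rightarrow> 'a \<times> 'a \<Rightarrow> real) set" where
  "profiles = (\<Pi>\<^sub>E f\<in>{1..F}. strategies f)"

definition centralized_optimum :: "(nat \<Rightarrow> 'a \<times> 'a \<Rightarrow> real) \<Rightarrow> bool" where
  "centralized_optimum x \<longleftrightarrow> is_arg_max shortest_length (\<lambda>y. y \<in> profiles) x"

definition pure_nash_equilibrium :: "(nat \<Rightarrow> 'a \<times> 'a \<Rightarrow> real) \<Rightarrow> bool" where
  "pure_nash_equilibrium x \<longleftrightarrow> x \<in> profiles \<and>
     (\<forall>f\<in>{1..F}. is_arg_max (\<lambda>y. shortest_length (x(f := y))) (\<lambda>y. y \<in> strategies f) (x f))"

end

end

theory Submission
  imports Defs
begin

text \<open>With a common source and target, every agent maximizes the same function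
  \<open>shortest_length\<close>, a common-payoff game. Each budget constrains one agent only, so a
  feasible unilateral deviation is again feasible for the centralized problem; if it improved the
  agent's payoff, it would beat the centralized optimum.\<close>

theorem proposition2:
  fixes G :: "'a pair_pre_digraph"
    and s t :: 'a
    and F :: nat
    and b :: "nat \<Rightarrow> real"
    and c :: "nat \<Rightarrow> 'a \<times> 'a \<Rightarrow> real"
    and d0 e :: "'a \<times> 'a \<Rightarrow> real"
    and x :: "nat \<Rightarrow> 'a \<times> 'a \<Rightarrow> real"
  assumes "dspi_game G s t F b c e"
    and "dspi_game.centralized_optimum G s t F b c d0 e x"
  shows "dspi_game.pure_nash_equilibrium G s t F b c d0 e x"
proof -
  interpret dspi_game G s t F b c d0 e by (rule assms(1))
  have x: "x \<in> profiles"
    and opt: "\<And>z. z \<in> profiles \<Longrightarrow> \<not> shortest_length x < shortest_length z"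
    using assms(2) by (auto simp: centralized_optimum_def is_arg_max_def)
  have "is_arg_max (\<lambda>y. shortest_length (x(f := y))) (\<lambda>y. y \<in> strategies f) (x f)"
    if f: "f \<in> {1..F}" for f
  proof -
    have "x f \<in> strategies f"
      using x f by (auto simp: profiles_def PiE_iff)
    \<comment> \<open>\<open>profiles\<close> is a product, so one factor can be changed freely;
      \<open>f\<close> lying in the index set keeps the update extensional.\<close>
    moreover have "x(f := y) \<in> profiles" if "y \<in> strategies f" for y
      using x f that by (auto simp: profiles_def PiE_iff extensional_def)
    \<comment> \<open>The deviation to \<open>x f\<close> itself gives back \<open>x\<close>, so
      \<open>opt\<close> compares exactly the two payoffs needed.\<close>
    ultimately show ?thesis
      using opt by (auto simp: is_arg_max_def)
  qed
  with x show ?thesis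
    by (simp add: pure_nash_equilibrium_def)
qed

end
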